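(* Let $G,K,H$ be graphs with $H\leq_R K\leq_R G$, let $\Psi\in\hom_R(G,K)$, $\Delta\in\hom_R(K,H)$, and $\Phi=\Delta\circ\Psi$. Then: (1) The $\sim_\Psi$ classes in $V(G)$ are exactly the nonempty intersections of $\sim_\Phi$ classes with $\partial\Psi$-fibers. In particular, $\Psi$ is synchronizing if and only if every $\partial\Psi$-fiber is contained in a $\sim_\Phi$ class. (2) If $K=G/\sim_\Phi$ and $\Psi$ is the quotient map for $\sim_\Phi$ (and $\Delta$ the induced map $G/\sim_\Phi\to H$), then $\Psi$ is synchronizing and $\sim_\Delta$ is trivial. (3) If $\sim_\Delta$ is trivial, then $\sim_\Phi\,=\,\sim_\Psi$. (4) $\Phi$ is synchronizing if and only if both $\Psi$ and $\Delta$ are synchronizing.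
   Context: All graphs are finite directed graphs with state set $V(G)$, edge set $E(G)$, source/target maps $s,t$; loops and parallel edges allowed; all graphs sink-free. $E_I(G)=s^{-1}(I)$, $L(G)$ finite edge paths, $L_I(G)$ those starting at $I$. A homomorphism $\Phi:G\to H$ consists of maps on edges and ($\partial\Phi$) on states commuting with $s,t$. A right-resolver is a surjective homomorphism with $\Phi|_{E_I(G)}:E_I(G)\to E_{\partial\Phi(I)}(H)$ bijective for all $I$; $\hom_R(G,H)$, $H\leq_R G$ if nonempty. For $\Phi\in\hom_R(G,H)$, $I\in V(G)$, $u\in L_{\partial\Phi(I)}(H)$, $I\cdot u$ is the endpoint of the unique $\gamma\in L_I(G)$ with $\Phi(\gamma)=u$. Stability relation: $I_1\sim_\Phi I_2$ iff $\partial\Phi(I_1)=\partial\Phi(I_2)=:I$ and for every $u\in L_I(H)$ there exists $v\in L_{t(u)}(H)$ with $I_1\cdot uv=I_2\cdot uv$; it is an equivalence relation, and it is a congruence: $I_1\sim_\Phi I_2$ implies $I_1\cdot u\sim_\Phi I_2\cdot u$. "Trivial" means equal to the equality relation. $\Phi$ is synchronizing if every fiber $(\partial\Phi)^{-1}(I)$ is a single $\sim_\Phi$ class. Quotient: $G/\sim_\Phi$ has states $V(G)/\sim_\Phi$ and edges the classes of edges under $e_1\sim e_2$ iff $\Phi(e_1)=\Phi(e_2)$ and $s(e_1)\sim_\Phi s(e_2)$, with source/target the classes of source/target; the quotient map $G\to G/\sim_\Phi$ and the map $G/\sim_\Phi\to H$ sending a class to the $\Phi$-image of a representative are right-resolvers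 composing to $\Phi$. *)

theory Defs
  imports "Graph_Theory.Arc_Walk" "HOL-Library.FuncSet"
begin

locale sink_free_digraph = fin_digraph +
  assumes sink_free: "v \<in> verts G \<Longrightarrow> out_arcs G v \<noteq> {}"

record ('a, 'b, 'c, 'd) digraph_map =
  vert_map :: "'a \<Rightarrow> 'c"
  arc_map :: "'b \<Rightarrow> 'd"

definition digraph_hom ::
  "('a, 'b) pre_digraph \<Rightarrow> ('c, 'd) pre_digraph \<Rightarrow> ('a, 'b, 'c, 'd) digraph_map set" where
  "digraph_hom G H = {\<Phi>.
     vert_map \<Phi> \<in> verts G \<rightarrow> verts H \<and>
     arc_map \<Phi> \<in> arcs G \<rightarrow> arcs H \<and>
     (\<forall>e\<in>arcs G. vert_map \<Phi> (tail G e) = tail H (arc_map \<Phi> e) \<and>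
                 vert_map \<Phi> (head G e) = head H (arc_map \<Phi> e))}"

definition hom_R ::
  "('a, 'b) pre_digraph \<Rightarrow> ('c, 'd) pre_digraph \<Rightarrow> ('a, 'b, 'c, 'd) digraph_map set" where
  "hom_R G H = {\<Phi> \<in> digraph_hom G H.
     vert_map \<Phi> ` verts G = verts H \<and>
     arc_map \<Phi> ` arcs G = arcs H \<and>
     (\<forall>I\<in>verts G. bij_betw (arc_map \<Phi>) (out_arcs G I) (out_arcs H (vert_map \<Phi> I)))}"

definition hom_comp ::
  "('c, 'd, 'e, 'f) digraph_map \<Rightarrow> ('a, 'b, 'c, 'd) digraph_map \<Rightarrow> ('a, 'b, 'e, 'f) digraph_map" where
  "hom_comp \<Delta> \<Psi> = \<lparr>vert_map = vert_map \<Delta> \<circ> vert_map \<Psi>, arc_map = arc_map \<Delta> \<circ> arc_map \<Psi>\<rparr>"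

text \<open>Only the values on the states and edges of the domain count; elsewhere the maps are arbitrary.\<close>
definition hom_eq ::
  "('a, 'b) pre_digraph \<Rightarrow> ('a, 'b, 'c, 'd) digraph_map \<Rightarrow> ('a, 'b, 'c, 'd) digraph_map \<Rightarrow> bool" where
  "hom_eq G \<Phi> \<Theta> \<longleftrightarrow>
     (\<forall>I\<in>verts G. vert_map \<Phi> I = vert_map \<Theta> I) \<and> (\<forall>e\<in>arcs G. arc_map \<Phi> e = arc_map \<Theta> e)"

text \<open>
  The state \<open>I \<cdot> u\<close>. It is specified only when \<open>\<Phi>\<close> is a right-resolver, \<open>I\<close> is a state and \<open>u\<close> is
  an edge path of the codomain starting at the image of \<open>I\<close>; see \<open>act_props\<close> and \<open>act_eqI\<close> below.
\<close>
definition act ::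
  "('a, 'b) pre_digraph \<Rightarrow> ('a, 'b, 'c, 'd) digraph_map \<Rightarrow> 'a \<Rightarrow> 'd list \<Rightarrow> 'a" where
  "act G \<Phi> I u = (THE J. \<exists>p. pre_digraph.awalk G I p J \<and> map (arc_map \<Phi>) p = u)"

text \<open>
  The stability relation, as a relation on the states of \<open>G\<close>. In \<open>awalk H I u J\<close> the state \<open>J\<close> is
  the terminal state of \<open>u\<close>; edge paths may be empty.
\<close>
definition stability ::
  "('a, 'b) pre_digraph \<Rightarrow> ('c, 'd) pre_digraph \<Rightarrow> ('a, 'b, 'c, 'd) digraph_map \<Rightarrow> 'a rel" where
  "stability G H \<Phi> = {(I\<^sub>1, I\<^sub>2). I\<^sub>1 \<in> verts G \<and> I\<^sub>2 \<in> verts G \<and> vert_map \<Phi> I\<^sub>1 = vert_map \<Phi> I\<^sub>2 \<and>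
     (\<forall>u J. pre_digraph.awalk H (vert_map \<Phi> I\<^sub>1) u J \<longrightarrow>
        (\<exists>v J'. pre_digraph.awalk H J v J' \<and> act G \<Phi> I\<^sub>1 (u @ v) = act G \<Phi> I\<^sub>2 (u @ v)))}"

definition trivial_stability ::
  "('a, 'b) pre_digraph \<Rightarrow> ('c, 'd) pre_digraph \<Rightarrow> ('a, 'b, 'c, 'd) digraph_map \<Rightarrow> bool" where
  "trivial_stability G H \<Phi> \<longleftrightarrow> stability G H \<Phi> = Id_on (verts G)"

definition fiber ::
  "('a, 'b) pre_digraph \<Rightarrow> ('a, 'b, 'c, 'd) digraph_map \<Rightarrow> 'c \<Rightarrow> 'a set" where
  "fiber G \<Phi> J = {I \<in> verts G. vert_map \<Phi> I = J}"

definition synchronizing ::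
  "('a, 'b) pre_digraph \<Rightarrow> ('c, 'd) pre_digraph \<Rightarrow> ('a, 'b, 'c, 'd) digraph_map \<Rightarrow> bool" where
  "synchronizing G H \<Phi> \<longleftrightarrow> (\<forall>J\<in>verts H. fiber G \<Phi> J \<in> verts G // stability G H \<Phi>)"

definition arc_stable ::
  "('a, 'b) pre_digraph \<Rightarrow> ('c, 'd) pre_digraph \<Rightarrow> ('a, 'b, 'c, 'd) digraph_map \<Rightarrow> 'b rel" where
  "arc_stable G H \<Phi> = {(e\<^sub>1, e\<^sub>2). e\<^sub>1 \<in> arcs G \<and> e\<^sub>2 \<in> arcs G \<and>
     arc_map \<Phi> e\<^sub>1 = arc_map \<Phi> e\<^sub>2 \<and> (tail G e\<^sub>1, tail G e\<^sub>2) \<in> stability G H \<Phi>}"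

text \<open>
  For a class \<open>c\<close> of edges the sets united in the source and target fields all coincide, so the
  union is the class of the source (target) of any representative; likewise the images below are
  singletons. See \<open>quotient_graph_tail\<close>, \<open>quotient_graph_head\<close>, \<open>induced_map_vert\<close> and
  \<open>induced_map_arc\<close>.
\<close>
definition quotient_graph ::
  "('a, 'b) pre_digraph \<Rightarrow> ('c, 'd) pre_digraph \<Rightarrow> ('a, 'b, 'c, 'd) digraph_map \<Rightarrow>
   ('a set, 'b set) pre_digraph" where
  "quotient_graph G H \<Phi> =
     \<lparr>verts = verts G // stability G H \<Phi>,
      arcs = arcs G // arc_stable G H \<Phi>,
      tail = (\<lambda>c. \<Union>e\<in>c. stability G H \<Phi> `` {tail G e}),
      head = (\<lambda>c. \<Union>e\<in>c. stability G H \<Phi> `` {head G e})\<rparr>"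

definition quotient_map ::
  "('a, 'b) pre_digraph \<Rightarrow> ('c, 'd) pre_digraph \<Rightarrow> ('a, 'b, 'c, 'd) digraph_map \<Rightarrow>
   ('a, 'b, 'a set, 'b set) digraph_map" where
  "quotient_map G H \<Phi> =
     \<lparr>vert_map = (\<lambda>I. stability G H \<Phi> `` {I}), arc_map = (\<lambda>e. arc_stable G H \<Phi> `` {e})\<rparr>"

definition induced_map ::
  "('a, 'b, 'c, 'd) digraph_map \<Rightarrow> ('a set, 'b set, 'c, 'd) digraph_map" where
  "induced_map \<Phi> =
     \<lparr>vert_map = (\<lambda>C. the_elem (vert_map \<Phi> ` C)), arc_map = (\<lambda>c. the_elem (arc_map \<Phi> ` c))\<rparr>"


subsection \<open>Well-definedness\<close>

locale right_resolver = G: sink_free_digraph G + H: sink_free_digraph H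
  for G :: "('a, 'b) pre_digraph" and H :: "('c, 'd) pre_digraph" +
  fixes \<Phi> :: "('a, 'b, 'c, 'd) digraph_map"
  assumes hom_R: "\<Phi> \<in> hom_R G H"
begin

abbreviation vm where "vm \<equiv> vert_map \<Phi>"
abbreviation am where "am \<equiv> arc_map \<Phi>"
abbreviation sim where "sim \<equiv> stability G H \<Phi>"
abbreviation asim where "asim \<equiv> arc_stable G H \<Phi>"

lemma vm_in: "I \<in> verts G \<Longrightarrow> vm I \<in> verts H"
  and am_in: "e \<in> arcs G \<Longrightarrow> am e \<in> arcs H"
  and vm_tail: "e \<in> arcs G \<Longrightarrow> vm (tail G e) = tail H (am e)"
  and vm_head: "e \<in> arcs G \<Longrightarrow> vm (head G e) = head H (am e)"
  and vm_surj: "vm ` verts G = verts H"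
  and am_surj: "am ` arcs G = arcs H"
  and am_bij: "I \<in> verts G \<Longrightarrow> bij_betw am (out_arcs G I) (out_arcs H (vm I))"
  using hom_R by (auto simp: hom_R_def digraph_hom_def Pi_def)

lemma am_inj:
  assumes "e \<in> arcs G" "e' \<in> arcs G" "tail G e = tail G e'" "am e = am e'"
  shows "e = e'"
  using am_bij[of "tail G e"] assms by (auto simp: bij_betw_def inj_on_def)

lemma am_lift:
  assumes "I \<in> verts G" "f \<in> arcs H" "tail H f = vm I"
  obtains e where "e \<in> arcs G" "tail G e = I" "am e = f"
proof -
  have "f \<in> am ` out_arcs G I"
    using am_bij[OF assms(1)] assms by (simp add: bij_betw_def)
  then show ?thesis using that by auto
qed

lemma awalk_image:
  assumes "G.awalk I p J"
  shows "H.awalk (vm I) (map am p) (vm J)"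
  using assms
proof (induction p arbitrary: I)
  case Nil
  then show ?case by (auto simp: G.awalk_Nil_iff H.awalk_Nil_iff vm_in)
next
  case (Cons e p)
  then have e: "e \<in> arcs G" "tail G e = I" "G.awalk (head G e) p J"
    by (auto simp: G.awalk_Cons_iff)
  have "H.awalk (head H (am e)) (map am p) (vm J)"
    using Cons.IH[OF e(3)] e(1) by (simp add: vm_head)
  then show ?case
    using e by (auto simp: H.awalk_Cons_iff am_in vm_tail)
qed

lemma awalk_lift:
  assumes "I \<in> verts G" "H.awalk (vm I) u J"
  shows "\<exists>p K. G.awalk I p K \<and> map am p = u \<and> vm K = J"
  using assms
proof (induction u arbitrary: I)
  case Nil
  then show ?case by (auto simp: G.awalk_Nil_iff H.awalk_Nil_iff)
next
  case (Cons f u)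
  then have f: "f \<in> arcs H" "tail H f = vm I" "H.awalk (head H f) u J"
    by (auto simp: H.awalk_Cons_iff)
  obtain e where e: "e \<in> arcs G" "tail G e = I" "am e = f"
    using am_lift[OF Cons.prems(1) f(1,2)] by blast
  have "H.awalk (vm (head G e)) u J"
    using f(3) e vm_head by metis
  then obtain p K where "G.awalk (head G e) p K" "map am p = u" "vm K = J"
    using Cons.IH[of "head G e"] e(1) by auto
  then have "G.awalk I (e # p) K \<and> map am (e # p) = f # u \<and> vm K = J"
    using e by (auto simp: G.awalk_Cons_iff)
  then show ?case by (intro exI)
qed

lemma awalk_unique:
  assumes "G.awalk I p K" "G.awalk I q L" "map am p = map am q"
  shows "p = q \<and> K = L"
  using assms
proof (induction p arbitrary: I q)
  case Nil
  then show ?case by (auto simp: G.awalk_Nil_iff)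
next
  case (Cons e p)
  then obtain e' q' where q: "q = e' # q'" by (cases q) auto
  have "e = e'"
    using Cons.prems by (intro am_inj) (auto simp: q G.awalk_Cons_iff)
  then show ?case
    using Cons.prems Cons.IH[of "head G e" q'] by (auto simp: q G.awalk_Cons_iff)
qed

lemma act_eqI:
  assumes "G.awalk I p K"
  shows "act G \<Phi> I (map am p) = K"
  unfolding act_def using assms awalk_unique by blast

lemma act_props:
  assumes "I \<in> verts G" "H.awalk (vm I) u J"
  shows "\<exists>p. G.awalk I p (act G \<Phi> I u) \<and> map am p = u"
    and "vm (act G \<Phi> I u) = J" and "act G \<Phi> I u \<in> verts G"
proof -
  obtain p K where p: "G.awalk I p K" "map am p = u" "vm K = J"
    using awalk_lift[OF assms] by blast
  then have "act G \<Phi> I u = K" using act_eqI by blast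
  with p show "\<exists>p. G.awalk I p (act G \<Phi> I u) \<and> map am p = u"
    "vm (act G \<Phi> I u) = J" "act G \<Phi> I u \<in> verts G" by auto
qed

lemma act_append:
  assumes "I \<in> verts G" "H.awalk (vm I) u J" "H.awalk J v J'"
  shows "act G \<Phi> I (u @ v) = act G \<Phi> (act G \<Phi> I u) v"
proof -
  obtain p where p: "G.awalk I p (act G \<Phi> I u)" "map am p = u"
    using act_props[OF assms(1,2)] by blast
  obtain q where q: "G.awalk (act G \<Phi> I u) q (act G \<Phi> (act G \<Phi> I u) v)" "map am q = v"
    using act_props[of "act G \<Phi> I u" v J'] act_props[OF assms(1,2)] assms(3) by auto
  have "G.awalk I (p @ q) (act G \<Phi> (act G \<Phi> I u) v)"
    using p q by (auto intro: G.awalk_appendI)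
  then show ?thesis using act_eqI[of I "p @ q"] p(2) q(2) by simp
qed

lemma sim_verts: "(I, I') \<in> sim \<Longrightarrow> I \<in> verts G" "(I, I') \<in> sim \<Longrightarrow> I' \<in> verts G"
  and sim_vm: "(I, I') \<in> sim \<Longrightarrow> vm I = vm I'"
  by (auto simp: stability_def)

lemma sim_congruence:
  assumes "(I, I') \<in> sim" "H.awalk (vm I) u J"
  shows "(act G \<Phi> I u, act G \<Phi> I' u) \<in> sim"
proof -
  have I: "I \<in> verts G" "I' \<in> verts G" and vm: "vm I' = vm I"
    using assms(1) by (auto simp: stability_def)
  have u': "H.awalk (vm I') u J" using assms(2) vm by simp
  note a = act_props[OF I(1) assms(2)] and a' = act_props[OF I(2) u']
  have "\<exists>w J''. H.awalk J' w J'' \<and>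
      act G \<Phi> (act G \<Phi> I u) (v @ w) = act G \<Phi> (act G \<Phi> I' u) (v @ w)"
    if v: "H.awalk J v J'" for v J'
  proof -
    have "H.awalk (vm I) (u @ v) J'" using assms(2) v by (rule H.awalk_appendI)
    then obtain w J'' where w: "H.awalk J' w J''"
      "act G \<Phi> I ((u @ v) @ w) = act G \<Phi> I' ((u @ v) @ w)"
      using assms(1) unfolding stability_def by blast
    have vw: "H.awalk J (v @ w) J''" using v w(1) by (rule H.awalk_appendI)
    show ?thesis
      using w act_append[OF I(1) assms(2) vw] act_append[OF I(2) u' vw] by auto
  qed
  then show ?thesis using a a' by (auto simp: stability_def)
qed

lemma equiv_sim: "equiv (verts G) sim"
proof (rule equivI)
  show "sim \<subseteq> verts G \<times> verts G" by (auto simp: stability_def)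
  show "refl_on (verts G) sim"
  proof (rule refl_onI)
    fix I assume "I \<in> verts G"
    moreover have "H.awalk J [] J" if "H.awalk (vm I) u J" for u J
      using that by (auto simp: H.awalk_Nil_iff)
    ultimately show "(I, I) \<in> sim" unfolding stability_def by blast
  qed
  show "sym sim"
  proof (rule symI)
    fix I I' assume a: "(I, I') \<in> sim"
    have "\<exists>v J'. H.awalk J v J' \<and> act G \<Phi> I' (u @ v) = act G \<Phi> I (u @ v)"
      if u: "H.awalk (vm I') u J" for u J
    proof -
      have "H.awalk (vm I) u J" using a u by (simp add: stability_def)
      then obtain v J' where "H.awalk J v J'" "act G \<Phi> I (u @ v) = act G \<Phi> I' (u @ v)"
        using a unfolding stability_def by blast
      then show ?thesis by metis
    qed
    then show "(I', I) \<in> sim" using a unfolding stability_def by simp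
  qed
  show "trans sim"
  proof (rule transI)
    fix I1 I2 I3 assume 12: "(I1, I2) \<in> sim" and 23: "(I2, I3) \<in> sim"
    have I: "I1 \<in> verts G" "I2 \<in> verts G" "I3 \<in> verts G"
      and vm: "vm I2 = vm I1" "vm I3 = vm I1"
      using 12 23 by (auto simp: stability_def)
    have "\<exists>v J'. H.awalk J v J' \<and> act G \<Phi> I1 (u @ v) = act G \<Phi> I3 (u @ v)"
      if u: "H.awalk (vm I1) u J" for u J
    proof -
      obtain v J' where v: "H.awalk J v J'" "act G \<Phi> I1 (u @ v) = act G \<Phi> I2 (u @ v)"
        using 12 u unfolding stability_def by blast
      have uv: "H.awalk (vm I1) (u @ v) J'" using u v(1) by (rule H.awalk_appendI)
      then have "H.awalk (vm I2) (u @ v) J'" using vm by simp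
      then obtain w J'' where w: "H.awalk J' w J''"
        "act G \<Phi> I2 ((u @ v) @ w) = act G \<Phi> I3 ((u @ v) @ w)"
        using 23 unfolding stability_def by blast
      have "act G \<Phi> I1 ((u @ v) @ w) = act G \<Phi> I2 ((u @ v) @ w)"
        using act_append[OF I(1) uv w(1)] act_append[of I2 "u @ v" J' w J''] I uv v(2) vm w(1)
        by simp
      then have "act G \<Phi> I1 (u @ (v @ w)) = act G \<Phi> I3 (u @ (v @ w))" using w by simp
      moreover have "H.awalk J (v @ w) J''" using v(1) w(1) by (rule H.awalk_appendI)
      ultimately show ?thesis by blast
    qed
    then show "(I1, I3) \<in> sim" using I vm by (auto simp: stability_def)
  qed
qed

lemma equiv_asim: "equiv (arcs G) asim"
proof (rule equivI)
  show "asim \<subseteq> arcs G \<times> arcs G" by (auto simp: arc_stable_def)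
  show "refl_on (arcs G) asim"
    using equiv_sim by (auto simp: refl_on_def arc_stable_def equiv_def)
  show "sym asim"
    using equiv_sim by (auto simp: sym_def arc_stable_def equiv_def)
  show "trans asim"
    using equiv_sim unfolding trans_def arc_stable_def equiv_def by simp blast
qed

lemma asim_tail: "(e, e') \<in> asim \<Longrightarrow> (tail G e, tail G e') \<in> sim"
  and asim_am: "(e, e') \<in> asim \<Longrightarrow> am e = am e'"
  by (auto simp: arc_stable_def)

lemma asim_head:
  assumes "(e, e') \<in> asim"
  shows "(head G e, head G e') \<in> sim"
proof -
  have e: "e \<in> arcs G" "e' \<in> arcs G" "am e = am e'" and t: "(tail G e, tail G e') \<in> sim"
    using assms by (auto simp: arc_stable_def)
  have "act G \<Phi> (tail G d) [am d] = head G d" if "d \<in> arcs G" for d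
    using act_eqI[of "tail G d" "[d]" "head G d"] that
    by (auto simp: G.awalk_Cons_iff G.awalk_Nil_iff)
  moreover have "H.awalk (vm (tail G e)) [am e] (head H (am e))"
    using e by (auto simp: H.awalk_Cons_iff H.awalk_Nil_iff vm_tail am_in)
  ultimately show ?thesis using sim_congruence[OF t] e by metis
qed

abbreviation Q where "Q \<equiv> quotient_graph G H \<Phi>"

lemma quotient_graph_tail:
  assumes "e \<in> arcs G" shows "tail Q (asim `` {e}) = sim `` {tail G e}"
proof -
  have "(\<lambda>e. sim `` {tail G e}) respects asim"
    using equiv_class_eq[OF equiv_sim] asim_tail by (auto intro!: congruentI)
  then show ?thesis
    using UN_equiv_class[OF equiv_asim _ assms] by (simp add: quotient_graph_def)
qed

lemma quotient_graph_head:
  assumes "e \<in> arcs G" shows "head Q (asim `` {e}) = sim `` {head G e}"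
proof -
  have "(\<lambda>e. sim `` {head G e}) respects asim"
    using equiv_class_eq[OF equiv_sim] asim_head by (auto intro!: congruentI)
  then show ?thesis
    using UN_equiv_class[OF equiv_asim _ assms] by (simp add: quotient_graph_def)
qed

lemma induced_map_vert:
  assumes "I \<in> verts G" shows "vert_map (induced_map \<Phi>) (sim `` {I}) = vm I"
proof -
  have "vm ` (sim `` {I}) = {vm I}"
    using equiv_class_self[OF equiv_sim assms] by (auto dest: sim_vm)
  then show ?thesis by (simp add: induced_map_def)
qed

lemma induced_map_arc:
  assumes "e \<in> arcs G" shows "arc_map (induced_map \<Phi>) (asim `` {e}) = am e"
proof -
  have "am ` (asim `` {e}) = {am e}"
    using equiv_class_self[OF equiv_asim assms] by (auto dest: asim_am)
  then show ?thesis by (simp add: induced_map_def)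
qed

lemma verts_Q: "verts Q = (\<lambda>I. sim `` {I}) ` verts G"
  and arcs_Q: "arcs Q = (\<lambda>e. asim `` {e}) ` arcs G"
  by (auto simp: quotient_graph_def quotient_def)

lemma out_arcs_Q:
  assumes "I \<in> verts G"
  shows "out_arcs Q (sim `` {I}) = (\<lambda>e. asim `` {e}) ` out_arcs G I"
proof (intro equalityI subsetI)
  fix c assume "c \<in> out_arcs Q (sim `` {I})"
  then obtain e where e: "e \<in> arcs G" "c = asim `` {e}" "sim `` {tail G e} = sim `` {I}"
    by (auto simp: arcs_Q quotient_graph_tail)
  then have s: "(tail G e, I) \<in> sim"
    using eq_equiv_class_iff[OF equiv_sim] assms by auto
  then have "tail H (am e) = vm I" using e vm_tail sim_vm by metis
  then obtain e' where e': "e' \<in> arcs G" "tail G e' = I" "am e' = am e"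
    using am_lift assms am_in e by metis
  then have "(e, e') \<in> asim" using e s by (auto simp: arc_stable_def)
  then have "c = asim `` {e'}" using e equiv_class_eq[OF equiv_asim] by blast
  then show "c \<in> (\<lambda>e. asim `` {e}) ` out_arcs G I" using e' by auto
next
  fix c assume "c \<in> (\<lambda>e. asim `` {e}) ` out_arcs G I"
  then show "c \<in> out_arcs Q (sim `` {I})"
    using quotient_graph_tail by (auto simp: arcs_Q)
qed

lemma sink_free_quotient_graph: "sink_free_digraph Q"
proof
  fix c assume "c \<in> arcs Q"
  then show "tail Q c \<in> verts Q" "head Q c \<in> verts Q"
    by (auto simp: arcs_Q verts_Q quotient_graph_tail quotient_graph_head)
next
  show "finite (verts Q)" "finite (arcs Q)" by (auto simp: verts_Q arcs_Q)
next
  fix C assume "C \<in> verts Q"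
  then show "out_arcs Q C \<noteq> {}" using G.sink_free by (auto simp only: verts_Q out_arcs_Q)
qed

lemma asim_eq_iff:
  assumes "e \<in> arcs G" "e' \<in> arcs G"
  shows "asim `` {e} = asim `` {e'} \<longleftrightarrow> (e, e') \<in> asim"
  using eq_equiv_class_iff[OF equiv_asim] assms by blast

lemma quotient_map_hom_R: "quotient_map G H \<Phi> \<in> hom_R G Q"
proof -
  have "inj_on (\<lambda>e. asim `` {e}) (out_arcs G I)" for I
    by (rule inj_onI) (auto simp: asim_eq_iff dest!: asim_am intro: am_inj)
  then show ?thesis
    by (auto simp: hom_R_def digraph_hom_def quotient_map_def verts_Q arcs_Q
        quotient_graph_tail quotient_graph_head out_arcs_Q bij_betw_def)
qed

lemma induced_map_hom_R: "induced_map \<Phi> \<in> hom_R Q H"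
proof -
  have "bij_betw (arc_map (induced_map \<Phi>)) (out_arcs Q (sim `` {I})) (out_arcs H (vm I))"
    if I: "I \<in> verts G" for I
  proof -
    have "arc_map (induced_map \<Phi>) ` out_arcs Q (sim `` {I}) = am ` out_arcs G I"
      by (simp only: out_arcs_Q[OF I] image_image)
        (rule image_cong, auto simp: induced_map_arc)
    moreover have "inj_on (arc_map (induced_map \<Phi>)) (out_arcs Q (sim `` {I}))"
    proof (rule inj_onI)
      fix c c' assume c: "c \<in> out_arcs Q (sim `` {I})" "c' \<in> out_arcs Q (sim `` {I})"
        "arc_map (induced_map \<Phi>) c = arc_map (induced_map \<Phi>) c'"
      obtain e e' where e: "e \<in> arcs G" "e' \<in> arcs G" "tail G e = I" "tail G e' = I"
        "c = asim `` {e}" "c' = asim `` {e'}"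
        using c(1,2) unfolding out_arcs_Q[OF I] image_iff in_out_arcs_conv Bex_def by blast
      then show "c = c'" using c(3) am_inj[of e e'] by (auto simp: induced_map_arc)
    qed
    ultimately show ?thesis using am_bij[OF I] by (simp add: bij_betw_def)
  qed
  moreover have "vert_map (induced_map \<Phi>) ` verts Q = verts H"
    unfolding verts_Q image_image vm_surj[symmetric]
    by (rule image_cong) (auto simp: induced_map_vert)
  moreover have "arc_map (induced_map \<Phi>) ` arcs Q = arcs H"
    unfolding arcs_Q image_image am_surj[symmetric]
    by (rule image_cong) (auto simp: induced_map_arc)
  ultimately show ?thesis
    by (auto simp: hom_R_def digraph_hom_def verts_Q arcs_Q vm_in am_in
        quotient_graph_tail quotient_graph_head induced_map_vert induced_map_arc vm_tail vm_head)
qed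

lemma induced_comp_quotient:
  "hom_eq G \<Phi> (hom_comp (induced_map \<Phi>) (quotient_map G H \<Phi>))"
  by (simp add: hom_eq_def hom_comp_def quotient_map_def induced_map_vert induced_map_arc)

end

end

theory Submission
  imports Defs
begin

text \<open>
  The action of \<open>G\<close> under \<open>\<Psi>\<close> along a path \<open>u\<close> of \<open>K\<close> is the action under \<open>\<Phi>\<close> along \<open>\<Delta>(u)\<close>, and
  \<open>\<partial>\<Psi>(I \<cdot> u) = \<partial>\<Psi>(I) \<cdot> u\<close> for paths \<open>u\<close> of \<open>H\<close>. Since paths of \<open>H\<close> lift uniquely to \<open>K\<close>, the first
  identity shows that \<open>I \<sim>\<^sub>\<Psi> I'\<close> iff \<open>I \<sim>\<^sub>\<Phi> I'\<close> and \<open>\<partial>\<Psi>(I) = \<partial>\<Psi>(I')\<close>; the second shows that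
  \<open>\<partial>\<Psi>\<close> maps \<open>\<sim>\<^sub>\<Phi>\<close> into \<open>\<sim>\<^sub>\<Delta>\<close>. If \<open>\<Psi>\<close> is synchronizing, then conversely
  \<open>\<partial>\<Psi>(I) \<sim>\<^sub>\<Delta> \<partial>\<Psi>(I')\<close> implies \<open>I \<sim>\<^sub>\<Phi> I'\<close>: a path merging the images brings \<open>I\<close> and \<open>I'\<close>
  into a common \<open>\<partial>\<Psi>\<close>-fiber, where they can then be merged.
\<close>

section \<open>Pointwise criteria for a single right-resolver\<close>

context right_resolver
begin

text \<open>A pairwise criterion that avoids quotient sets. Surjectivity on states makes every fiber
  nonempty, so a fiber whose states are pairwise stable is the class of any state in it.\<close>

lemma synchronizing_iff:
  "synchronizing G H \<Phi> \<longleftrightarrow>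
     (\<forall>I\<in>verts G. \<forall>I'\<in>verts G. vm I = vm I' \<longrightarrow> (I, I') \<in> sim)"
proof
  assume s: "synchronizing G H \<Phi>"
  show "\<forall>I\<in>verts G. \<forall>I'\<in>verts G. vm I = vm I' \<longrightarrow> (I, I') \<in> sim"
  proof (intro ballI impI)
    fix I I' assume I: "I \<in> verts G" "I' \<in> verts G" "vm I = vm I'"
    then have "fiber G \<Phi> (vm I) \<in> verts G // sim" "I \<in> fiber G \<Phi> (vm I)" "I' \<in> fiber G \<Phi> (vm I)"
      using s by (auto simp: synchronizing_def fiber_def vm_in)
    then show "(I, I') \<in> sim" using quotient_eq_iff[OF equiv_sim] by blast
  qed
next
  assume s: "\<forall>I\<in>verts G. \<forall>I'\<in>verts G. vm I = vm I' \<longrightarrow> (I, I') \<in> sim"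
  show "synchronizing G H \<Phi>"
    unfolding synchronizing_def
  proof
    fix J assume "J \<in> verts H"
    then obtain I where I: "I \<in> verts G" "vm I = J" by (metis imageE vm_surj)
    have "L \<in> fiber G \<Phi> J \<longleftrightarrow> (I, L) \<in> sim" for L
    proof
      assume "L \<in> fiber G \<Phi> J"
      then have "L \<in> verts G" "vm I = vm L" using I by (auto simp: fiber_def)
      then show "(I, L) \<in> sim" using s I(1) by blast
    next
      assume L: "(I, L) \<in> sim"
      show "L \<in> fiber G \<Phi> J" using sim_verts(2)[OF L] sim_vm[OF L] I(2) by (simp add: fiber_def)
    qed
    then have "fiber G \<Phi> J = sim `` {I}" by blast
    then show "fiber G \<Phi> J \<in> verts G // sim" using I by (auto intro: quotientI)
  qed
qed

lemma simI:
  assumes "I \<in> verts G" "I' \<in> verts G" "vm I = vm I'"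
    and "\<And>u J. H.awalk (vm I) u J \<Longrightarrow>
      \<exists>v J'. H.awalk J v J' \<and> act G \<Phi> I (u @ v) = act G \<Phi> I' (u @ v)"
  shows "(I, I') \<in> sim"
  using assms unfolding stability_def by blast

lemma simE:
  assumes "(I, I') \<in> sim" "H.awalk (vm I) u J"
  obtains v J' where "H.awalk J v J'" "act G \<Phi> I (u @ v) = act G \<Phi> I' (u @ v)"
  using assms unfolding stability_def by blast

text \<open>It suffices to reach stable pairs instead of equal states: stability of the pair reached
  supplies a further path that merges it.\<close>

lemma sim_if_act_sim:
  assumes I: "I \<in> verts G" "I' \<in> verts G" "vm I = vm I'"
    and merge: "\<And>u J. H.awalk (vm I) u J \<Longrightarrow>
      \<exists>v J'. H.awalk J v J' \<and> (act G \<Phi> I (u @ v), act G \<Phi> I' (u @ v)) \<in> sim"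
  shows "(I, I') \<in> sim"
proof (rule simI[OF I])
  fix u J assume u: "H.awalk (vm I) u J"
  from merge[OF u] obtain v J' where v: "H.awalk J v J'"
    and s: "(act G \<Phi> I (u @ v), act G \<Phi> I' (u @ v)) \<in> sim" by blast
  have uv: "H.awalk (vm I) (u @ v) J'" using u v by (rule H.awalk_appendI)
  then have uv': "H.awalk (vm I') (u @ v) J'" using I by simp
  \<comment> \<open>Stability of the pair reached is used along the empty path, so that
    \<open>w\<close> continues directly from \<open>J'\<close>.\<close>
  have "H.awalk (vm (act G \<Phi> I (u @ v))) [] J'"
    using act_props(2,3)[OF I(1) uv] vm_in by (auto simp: H.awalk_Nil_iff)
  then obtain w J'' where w: "H.awalk J' w J''"
    "act G \<Phi> (act G \<Phi> I (u @ v)) ([] @ w) = act G \<Phi> (act G \<Phi> I' (u @ v)) ([] @ w)"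
    by (rule simE[OF s])
  then have "act G \<Phi> I (u @ v @ w) = act G \<Phi> I' (u @ v @ w)"
    using act_append[OF I(1) uv w(1)] act_append[OF I(2) uv' w(1)] by simp
  then show "\<exists>v J'. H.awalk J v J' \<and> act G \<Phi> I (u @ v) = act G \<Phi> I' (u @ v)"
    using H.awalk_appendI[OF v w(1)] by blast
qed

end

section \<open>Factorization through an intermediate graph\<close>

lemma hom_R_comp:
  assumes "\<Psi> \<in> hom_R G K" "\<Delta> \<in> hom_R K H" "hom_eq G \<Phi> (hom_comp \<Delta> \<Psi>)"
    and "wf_digraph G"
  shows "\<Phi> \<in> hom_R G H"
proof -
  interpret wf_digraph G by fact
  have v: "vert_map \<Phi> I = vert_map \<Delta> (vert_map \<Psi> I)" if "I \<in> verts G" for I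
    using assms(3) that by (simp add: hom_eq_def hom_comp_def)
  have a: "arc_map \<Phi> e = arc_map \<Delta> (arc_map \<Psi> e)" if "e \<in> arcs G" for e
    using assms(3) that by (simp add: hom_eq_def hom_comp_def)
  have "vert_map \<Phi> ` verts G = vert_map \<Delta> ` vert_map \<Psi> ` verts G"
    unfolding image_image by (rule image_cong) (auto simp: v)
  moreover have "arc_map \<Phi> ` arcs G = arc_map \<Delta> ` arc_map \<Psi> ` arcs G"
    unfolding image_image by (rule image_cong) (auto simp: a)
  moreover have "bij_betw (arc_map \<Phi>) (out_arcs G I) (out_arcs H (vert_map \<Phi> I))"
    if I: "I \<in> verts G" for I
  proof -
    have "bij_betw (arc_map \<Delta> \<circ> arc_map \<Psi>) (out_arcs G I) (out_arcs H (vert_map \<Phi> I))"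
      using assms(1,2) I unfolding v[OF I]
      by (intro bij_betw_trans[where B = "out_arcs K (vert_map \<Psi> I)"])
        (auto simp: hom_R_def digraph_hom_def Pi_def)
    \<comment> \<open>\<open>hom_eq\<close> relates \<open>\<Phi>\<close> to the composite only on
      \<open>G\<close>, so bijectivity is transferred by pointwise agreement on the outgoing
      edges.\<close>
    then show ?thesis by (rule bij_betw_cong[THEN iffD1, rotated]) (simp add: a)
  qed
  ultimately show ?thesis
    using assms(1,2) by (auto simp: hom_R_def digraph_hom_def Pi_def v a)
qed

text \<open>\<open>\<Phi>\<close> is a parameter of its own, tied to the composite by
  \<open>hom_eq\<close>: a given resolver is only known to agree on \<open>G\<close> with the
  composite through its quotient.\<close>

locale resolver_factorization =
  \<Psi>: right_resolver G K \<Psi> + \<Delta>: right_resolver K H \<Delta> + \<Phi>: right_resolver G H \<Phi>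
  for G :: "('a, 'b) pre_digraph" and K :: "('c, 'd) pre_digraph" and H :: "('e, 'f) pre_digraph"
    and \<Psi> \<Delta> \<Phi> +
  assumes factorization: "hom_eq G \<Phi> (hom_comp \<Delta> \<Psi>)"
begin

lemma vm_comp: "I \<in> verts G \<Longrightarrow> \<Phi>.vm I = \<Delta>.vm (\<Psi>.vm I)"
  and am_comp: "e \<in> arcs G \<Longrightarrow> \<Phi>.am e = \<Delta>.am (\<Psi>.am e)"
  using factorization by (auto simp: hom_eq_def hom_comp_def)

lemma map_am_comp: "\<Psi>.G.awalk I p J \<Longrightarrow> map \<Phi>.am p = map \<Delta>.am (map \<Psi>.am p)"
  by (auto simp: \<Psi>.G.awalk_def am_comp)

text \<open>One and the same path of \<open>G\<close> lifts \<open>u\<close> along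
  \<open>\<Psi>\<close> and its \<open>\<Delta>\<close>-image along \<open>\<Phi>\<close>.\<close>

lemma act_eq_act_image:
  assumes "I \<in> verts G" "\<Psi>.H.awalk (\<Psi>.vm I) u J"
  shows "act G \<Psi> I u = act G \<Phi> I (map \<Delta>.am u)"
  using \<Psi>.act_props(1)[OF assms] \<Phi>.act_eqI map_am_comp by metis

text \<open>The \<open>\<Psi>\<close>-image of the lift of \<open>u\<close> to \<open>G\<close> is a
  lift of \<open>u\<close> to \<open>K\<close>, and such lifts are unique.\<close>

lemma vm_act:
  assumes "I \<in> verts G" "\<Delta>.H.awalk (\<Phi>.vm I) u J"
  shows "\<Psi>.vm (act G \<Phi> I u) = act K \<Delta> (\<Psi>.vm I) u"
proof -
  obtain p where p: "\<Psi>.G.awalk I p (act G \<Phi> I u)" "map \<Phi>.am p = u"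
    using \<Phi>.act_props(1)[OF assms] by blast
  then show ?thesis
    using \<Delta>.act_eqI[OF \<Psi>.awalk_image[OF p(1)]] map_am_comp[OF p(1)] by simp
qed

lemma sim_\<Psi>_iff: "(I, I') \<in> \<Psi>.sim \<longleftrightarrow> (I, I') \<in> \<Phi>.sim \<and> \<Psi>.vm I = \<Psi>.vm I'"
proof
  assume s: "(I, I') \<in> \<Psi>.sim"
  note I = \<Psi>.sim_verts[OF s] and vm = \<Psi>.sim_vm[OF s]
  have "(I, I') \<in> \<Phi>.sim"
  proof (rule \<Phi>.simI)
    fix u J assume "\<Delta>.H.awalk (\<Phi>.vm I) u J"
    then have "\<Delta>.H.awalk (\<Delta>.vm (\<Psi>.vm I)) u J" using I by (simp add: vm_comp)
    \<comment> \<open>The hypothesis concerns paths of \<open>K\<close>, so \<open>u\<close> is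
      lifted there first; the merging path found in \<open>K\<close> is then projected back to
      \<open>H\<close>.\<close>
    then obtain p L where p: "\<Psi>.H.awalk (\<Psi>.vm I) p L" "map \<Delta>.am p = u" "\<Delta>.vm L = J"
      using \<Delta>.awalk_lift \<Psi>.vm_in I by blast
    obtain q L' where q: "\<Psi>.H.awalk L q L'" "act G \<Psi> I (p @ q) = act G \<Psi> I' (p @ q)"
      using \<Psi>.simE[OF s p(1)] by blast
    have pq: "\<Psi>.H.awalk (\<Psi>.vm I) (p @ q) L'" using p(1) q(1) by (rule \<Psi>.H.awalk_appendI)
    then have pq': "\<Psi>.H.awalk (\<Psi>.vm I') (p @ q) L'" using vm by simp
    then have "act G \<Phi> I (u @ map \<Delta>.am q) = act G \<Phi> I' (u @ map \<Delta>.am q)"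
      using act_eq_act_image[OF I(1) pq] act_eq_act_image[OF I(2) pq'] q(2) p(2) by simp
    then show "\<exists>v J'. \<Delta>.H.awalk J v J' \<and> act G \<Phi> I (u @ v) = act G \<Phi> I' (u @ v)"
      using \<Delta>.awalk_image[OF q(1)] p(3) by blast
  qed (use I vm in \<open>auto simp: vm_comp\<close>)
  with vm show "(I, I') \<in> \<Phi>.sim \<and> \<Psi>.vm I = \<Psi>.vm I'" by simp
next
  assume "(I, I') \<in> \<Phi>.sim \<and> \<Psi>.vm I = \<Psi>.vm I'"
  then have s: "(I, I') \<in> \<Phi>.sim" and vm: "\<Psi>.vm I = \<Psi>.vm I'" by auto
  note I = \<Phi>.sim_verts[OF s]
  show "(I, I') \<in> \<Psi>.sim"
  proof (rule \<Psi>.simI[OF I vm])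
    fix p L assume p: "\<Psi>.H.awalk (\<Psi>.vm I) p L"
    then have "\<Delta>.H.awalk (\<Phi>.vm I) (map \<Delta>.am p) (\<Delta>.vm L)"
      using \<Delta>.awalk_image I by (simp add: vm_comp)
    then obtain v J' where v: "\<Delta>.H.awalk (\<Delta>.vm L) v J'"
      "act G \<Phi> I (map \<Delta>.am p @ v) = act G \<Phi> I' (map \<Delta>.am p @ v)"
      using \<Phi>.simE[OF s] by blast
    have "L \<in> verts K" using p by auto
    \<comment> \<open>The merging path is lifted from \<open>L\<close>, the end of \<open>p\<close>,
      so that \<open>p @ q\<close> is a path of \<open>K\<close>.\<close>
    then obtain q L' where q: "\<Psi>.H.awalk L q L'" "map \<Delta>.am q = v"
      using \<Delta>.awalk_lift v(1) by blast
    have pq: "\<Psi>.H.awalk (\<Psi>.vm I) (p @ q) L'" using p q(1) by (rule \<Psi>.H.awalk_appendI)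
    then have pq': "\<Psi>.H.awalk (\<Psi>.vm I') (p @ q) L'" using vm by simp
    then have "act G \<Psi> I (p @ q) = act G \<Psi> I' (p @ q)"
      using act_eq_act_image[OF I(1) pq] act_eq_act_image[OF I(2) pq'] q(2) v(2) by simp
    then show "\<exists>q L'. \<Psi>.H.awalk L q L' \<and> act G \<Psi> I (p @ q) = act G \<Psi> I' (p @ q)"
      using q(1) by blast
  qed
qed

text \<open>A path that merges two states of \<open>G\<close> also merges their images, by
  \<open>vm_act\<close>.\<close>

lemma sim_image:
  assumes s: "(I, I') \<in> \<Phi>.sim"
  shows "(\<Psi>.vm I, \<Psi>.vm I') \<in> \<Delta>.sim"
proof -
  note I = \<Phi>.sim_verts[OF s] and vm = \<Phi>.sim_vm[OF s]
  show ?thesis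
  proof (rule \<Delta>.simI)
    fix u J assume "\<Delta>.H.awalk (\<Delta>.vm (\<Psi>.vm I)) u J"
    then have u: "\<Delta>.H.awalk (\<Phi>.vm I) u J" using I by (simp add: vm_comp)
    obtain v J' where v: "\<Delta>.H.awalk J v J'" "act G \<Phi> I (u @ v) = act G \<Phi> I' (u @ v)"
      using \<Phi>.simE[OF s u] by blast
    have uv: "\<Delta>.H.awalk (\<Phi>.vm I) (u @ v) J'" using u v(1) by (rule \<Delta>.H.awalk_appendI)
    then have uv': "\<Delta>.H.awalk (\<Phi>.vm I') (u @ v) J'" using vm by simp
    then have "act K \<Delta> (\<Psi>.vm I) (u @ v) = act K \<Delta> (\<Psi>.vm I') (u @ v)"
      using vm_act[OF I(1) uv] vm_act[OF I(2) uv'] v(2) by simp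
    with v(1) show "\<exists>v J'. \<Delta>.H.awalk J v J' \<and>
        act K \<Delta> (\<Psi>.vm I) (u @ v) = act K \<Delta> (\<Psi>.vm I') (u @ v)" by blast
  qed (use I vm in \<open>auto simp: vm_comp \<Psi>.vm_in\<close>)
qed

lemma sim_if_sim_image:
  assumes sync: "synchronizing G K \<Psi>"
    and I: "I \<in> verts G" "I' \<in> verts G" and s: "(\<Psi>.vm I, \<Psi>.vm I') \<in> \<Delta>.sim"
  shows "(I, I') \<in> \<Phi>.sim"
proof -
  have vm: "\<Phi>.vm I = \<Phi>.vm I'" using \<Delta>.sim_vm[OF s] I by (simp add: vm_comp)
  show ?thesis
  proof (rule \<Phi>.sim_if_act_sim[OF I vm])
    fix u J assume u: "\<Delta>.H.awalk (\<Phi>.vm I) u J"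
    then have "\<Delta>.H.awalk (\<Delta>.vm (\<Psi>.vm I)) u J" using I by (simp add: vm_comp)
    then obtain v J' where v: "\<Delta>.H.awalk J v J'"
      "act K \<Delta> (\<Psi>.vm I) (u @ v) = act K \<Delta> (\<Psi>.vm I') (u @ v)"
      using \<Delta>.simE[OF s] by blast
    have uv: "\<Delta>.H.awalk (\<Phi>.vm I) (u @ v) J'" using u v(1) by (rule \<Delta>.H.awalk_appendI)
    then have uv': "\<Delta>.H.awalk (\<Phi>.vm I') (u @ v) J'" using vm by simp
    have "\<Psi>.vm (act G \<Phi> I (u @ v)) = \<Psi>.vm (act G \<Phi> I' (u @ v))"
      using vm_act[OF I(1) uv] vm_act[OF I(2) uv'] v(2) by simp
    \<comment> \<open>Synchronization of \<open>\<Psi>\<close> enters here: the two states reached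
      lie in one \<open>\<Psi>\<close>-fiber.\<close>
    then have "(act G \<Phi> I (u @ v), act G \<Phi> I' (u @ v)) \<in> \<Psi>.sim"
      using sync \<Phi>.act_props(3)[OF I(1) uv] \<Phi>.act_props(3)[OF I(2) uv']
      by (simp add: \<Psi>.synchronizing_iff)
    with v(1) show "\<exists>v J'. \<Delta>.H.awalk J v J' \<and>
        (act G \<Phi> I (u @ v), act G \<Phi> I' (u @ v)) \<in> \<Phi>.sim"
      by (auto simp: sim_\<Psi>_iff)
  qed
qed

lemma sim_\<Psi>_class: "I \<in> verts G \<Longrightarrow> \<Psi>.sim `` {I} = \<Phi>.sim `` {I} \<inter> fiber G \<Psi> (\<Psi>.vm I)"
  by (auto simp: fiber_def sim_\<Psi>_iff dest: \<Phi>.sim_verts)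

lemma \<Psi>_classes:
  "verts G // \<Psi>.sim =
     {C \<inter> fiber G \<Psi> J | C J. C \<in> verts G // \<Phi>.sim \<and> J \<in> verts K \<and> C \<inter> fiber G \<Psi> J \<noteq> {}}"
proof (intro equalityI subsetI)
  fix D assume "D \<in> verts G // \<Psi>.sim"
  then obtain I where I: "I \<in> verts G" "D = \<Psi>.sim `` {I}" by (rule quotientE)
  then have "D \<noteq> {}" using equiv_class_self[OF \<Psi>.equiv_sim] by blast
  then show "D \<in> {C \<inter> fiber G \<Psi> J | C J.
      C \<in> verts G // \<Phi>.sim \<and> J \<in> verts K \<and> C \<inter> fiber G \<Psi> J \<noteq> {}}"
    using I sim_\<Psi>_class[OF I(1)] quotientI[OF I(1)] \<Psi>.vm_in[OF I(1)] by blast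
next
  fix D assume "D \<in> {C \<inter> fiber G \<Psi> J | C J.
      C \<in> verts G // \<Phi>.sim \<and> J \<in> verts K \<and> C \<inter> fiber G \<Psi> J \<noteq> {}}"
  \<comment> \<open>A point \<open>I\<close> of the intersection determines both \<open>C\<close>
    and \<open>J\<close>, which reduces the claim to \<open>sim_\<Psi>_class\<close>.\<close>
  then obtain C J I where D: "D = C \<inter> fiber G \<Psi> J" "C \<in> verts G // \<Phi>.sim"
    and I: "I \<in> C" "I \<in> fiber G \<Psi> J" by blast
  have "I \<in> verts G" "J = \<Psi>.vm I" using I by (auto simp: fiber_def)
  moreover have "C = \<Phi>.sim `` {I}"
    using D(2) I(1) by (metis Image_singleton_iff \<Phi>.equiv_sim equiv_class_eq quotientE)
  ultimately show "D \<in> verts G // \<Psi>.sim"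
    using D(1) sim_\<Psi>_class quotientI by metis
qed

lemma synchronizing_\<Psi>_iff:
  "synchronizing G K \<Psi> \<longleftrightarrow> (\<forall>J\<in>verts K. \<exists>C\<in>verts G // \<Phi>.sim. fiber G \<Psi> J \<subseteq> C)"
proof
  assume s: "synchronizing G K \<Psi>"
  show "\<forall>J\<in>verts K. \<exists>C\<in>verts G // \<Phi>.sim. fiber G \<Psi> J \<subseteq> C"
  proof
    fix J assume "J \<in> verts K"
    then have "fiber G \<Psi> J \<in> verts G // \<Psi>.sim" using s by (simp add: synchronizing_def)
    then show "\<exists>C\<in>verts G // \<Phi>.sim. fiber G \<Psi> J \<subseteq> C" unfolding \<Psi>_classes by blast
  qed
next
  assume s: "\<forall>J\<in>verts K. \<exists>C\<in>verts G // \<Phi>.sim. fiber G \<Psi> J \<subseteq> C"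
  show "synchronizing G K \<Psi>"
    unfolding \<Psi>.synchronizing_iff
  proof (intro ballI impI)
    fix I I' assume I: "I \<in> verts G" "I' \<in> verts G" "\<Psi>.vm I = \<Psi>.vm I'"
    then obtain C where "C \<in> verts G // \<Phi>.sim" "I \<in> C" "I' \<in> C"
      using s \<Psi>.vm_in[OF I(1)] by (force simp: fiber_def)
    then show "(I, I') \<in> \<Psi>.sim"
      using I(3) quotient_eq_iff[OF \<Phi>.equiv_sim] by (auto simp: sim_\<Psi>_iff)
  qed
qed

text \<open>By \<open>sim_image\<close>, triviality forces \<open>\<Phi>\<close>-stable states to
  have equal \<open>\<Psi>\<close>-images, so the extra condition in \<open>sim_\<Psi>_iff\<close>
  holds automatically.\<close>

lemma sim_\<Phi>_eq_sim_\<Psi>: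
  assumes "trivial_stability K H \<Delta>"
  shows "\<Phi>.sim = \<Psi>.sim"
proof -
  have "\<Psi>.vm I = \<Psi>.vm I'" if "(I, I') \<in> \<Phi>.sim" for I I'
    using sim_image[OF that] assms by (simp add: trivial_stability_def Id_on_iff)
  then show ?thesis by (auto simp: sim_\<Psi>_iff)
qed

lemma synchronizing_\<Phi>_iff:
  "synchronizing G H \<Phi> \<longleftrightarrow> synchronizing G K \<Psi> \<and> synchronizing K H \<Delta>"
proof
  assume "synchronizing G H \<Phi>"
  then have s: "(I, I') \<in> \<Phi>.sim"
    if "I \<in> verts G" "I' \<in> verts G" "\<Delta>.vm (\<Psi>.vm I) = \<Delta>.vm (\<Psi>.vm I')" for I I'
    using that vm_comp unfolding \<Phi>.synchronizing_iff by metis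
  \<comment> \<open>States of \<open>K\<close> are taken as images of states of \<open>G\<close>,
    where \<open>sim_image\<close> applies; surjectivity of \<open>\<Psi>\<close> covers all of
    \<open>K\<close>.\<close>
  have "(J, J') \<in> \<Delta>.sim" if J: "J \<in> \<Psi>.vm ` verts G" "J' \<in> \<Psi>.vm ` verts G" "\<Delta>.vm J = \<Delta>.vm J'"
    for J J'
    using J s sim_image by blast
  then have "synchronizing K H \<Delta>"
    unfolding \<Delta>.synchronizing_iff \<Psi>.vm_surj by blast
  moreover have "synchronizing G K \<Psi>"
    unfolding \<Psi>.synchronizing_iff sim_\<Psi>_iff using s by metis
  ultimately show "synchronizing G K \<Psi> \<and> synchronizing K H \<Delta>" by blast
next
  assume "synchronizing G K \<Psi> \<and> synchronizing K H \<Delta>"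
  then show "synchronizing G H \<Phi>"
    using sim_if_sim_image
    by (simp add: \<Phi>.synchronizing_iff \<Delta>.synchronizing_iff vm_comp \<Psi>.vm_in)
qed

end

section \<open>The quotient by the stability relation\<close>

context right_resolver
begin

lemma quotient_factorization:
  "resolver_factorization G Q H (quotient_map G H \<Phi>) (induced_map \<Phi>) \<Phi>"
proof -
  interpret Q: sink_free_digraph Q by (rule sink_free_quotient_graph)
  show ?thesis
    by unfold_locales
      (rule quotient_map_hom_R induced_map_hom_R induced_comp_quotient)+
qed

lemma quotient_map_vert: "vert_map (quotient_map G H \<Phi>) I = sim `` {I}"
  by (simp add: quotient_map_def)

text \<open>The fibers of the quotient map are the stability classes themselves, so
  \<open>sim_\<Psi>_iff\<close> gives the claim.\<close>

lemma synchronizing_quotient_map: "synchronizing G Q (quotient_map G H \<Phi>)"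
proof -
  interpret F: resolver_factorization G Q H "quotient_map G H \<Phi>" "induced_map \<Phi>" \<Phi>
    by (rule quotient_factorization)
  show ?thesis
    unfolding F.\<Psi>.synchronizing_iff
    by (auto simp: F.sim_\<Psi>_iff quotient_map_vert eq_equiv_class_iff[OF equiv_sim])
qed

text \<open>Since the quotient map is synchronizing, stability of two classes under the induced map
  pulls back to stability of their representatives, so the classes coincide.\<close>

lemma trivial_stability_induced_map: "trivial_stability Q H (induced_map \<Phi>)"
proof -
  interpret F: resolver_factorization G Q H "quotient_map G H \<Phi>" "induced_map \<Phi>" \<Phi>
    by (rule quotient_factorization)
  have "C = C'" if s: "(C, C') \<in> F.\<Delta>.sim" for C C'
  proof -
    obtain I I' where I: "I \<in> verts G" "I' \<in> verts G" "C = sim `` {I}" "C' = sim `` {I'}"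
      using F.\<Delta>.sim_verts[OF s] by (auto simp: verts_Q)
    then have "(I, I') \<in> sim"
      using s F.sim_if_sim_image[OF synchronizing_quotient_map] by (simp add: quotient_map_vert)
    then show ?thesis using I equiv_class_eq[OF equiv_sim] by simp
  qed
  moreover have "(C, C) \<in> F.\<Delta>.sim" if "C \<in> verts Q" for C
    using that F.\<Delta>.equiv_sim by (auto simp: equiv_def refl_on_def)
  ultimately show ?thesis
    unfolding trivial_stability_def by (auto dest: F.\<Delta>.sim_verts)
qed

end

theorem theorem3p9:
  fixes G :: "('a, 'b) pre_digraph" and K :: "('c, 'd) pre_digraph" and H :: "('e, 'f) pre_digraph"
    and \<Psi> :: "('a, 'b, 'c, 'd) digraph_map" and \<Delta> :: "('c, 'd, 'e, 'f) digraph_map"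
    and \<Phi> :: "('a, 'b, 'e, 'f) digraph_map"
  assumes "sink_free_digraph G" and "sink_free_digraph K" and "sink_free_digraph H"
    and "\<Psi> \<in> hom_R G K" and "\<Delta> \<in> hom_R K H" and "hom_eq G \<Phi> (hom_comp \<Delta> \<Psi>)"
  shows
    "(verts G // stability G K \<Psi> =
        {C \<inter> fiber G \<Psi> J | C J. C \<in> verts G // stability G H \<Phi> \<and> J \<in> verts K \<and> C \<inter> fiber G \<Psi> J \<noteq> {}} \<and>
      (synchronizing G K \<Psi> \<longleftrightarrow>
        (\<forall>J\<in>verts K. \<exists>C\<in>verts G // stability G H \<Phi>. fiber G \<Psi> J \<subseteq> C))) \<and>
     (\<forall>\<Phi>'\<in>hom_R G H.
        synchronizing G (quotient_graph G H \<Phi>') (quotient_map G H \<Phi>') \<and>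
        trivial_stability (quotient_graph G H \<Phi>') H (induced_map \<Phi>')) \<and>
     (trivial_stability K H \<Delta> \<longrightarrow> stability G H \<Phi> = stability G K \<Psi>) \<and>
     (synchronizing G H \<Phi> \<longleftrightarrow> synchronizing G K \<Psi> \<and> synchronizing K H \<Delta>)"
proof -
  interpret G: sink_free_digraph G by fact
  interpret K: sink_free_digraph K by fact
  interpret H: sink_free_digraph H by fact
  have "\<Phi> \<in> hom_R G H" using hom_R_comp assms(4-6) G.wf_digraph_axioms by blast
  then interpret F: resolver_factorization G K H \<Psi> \<Delta> \<Phi>
    using assms(4-6) by unfold_locales
  \<comment> \<open>The quotient statement is proved for every resolver from \<open>G\<close> to
    \<open>H\<close>, in a separate interpretation that does not involve \<open>K\<close>.\<close>
  have "synchronizing G (quotient_graph G H \<Phi>') (quotient_map G H \<Phi>') \<and>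
      trivial_stability (quotient_graph G H \<Phi>') H (induced_map \<Phi>')" if "\<Phi>' \<in> hom_R G H" for \<Phi>'
  proof -
    interpret R: right_resolver G H \<Phi>' using that by unfold_locales
    show ?thesis
      using R.synchronizing_quotient_map R.trivial_stability_induced_map by blast
  qed
  then show ?thesis
    using F.\<Psi>_classes F.synchronizing_\<Psi>_iff F.sim_\<Phi>_eq_sim_\<Psi> F.synchronizing_\<Phi>_iff by blast
qed

end
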